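(* Let $G$ be an SCT graph with $n$ vertices. No solution lying on a positive dimensional component of the solution set (with the trivial rotational symmetry removed) is linearly stable. That is, let $X$ be an irreducible component of positive dimension of the complex affine algebraic set $\mathbb{V}(I_K)\cap\{x_0=1,\ y_0=0\}$, and let $\theta^*=(\theta_0^*,\ldots,\theta_{n-1}^* )\in\mathbb{R}^n$ with $\theta_0^*=0$ be a solution of the homogeneous Kuramoto system on $G$ whose corresponding point, given by $x_i=\cos(\theta_i^* )$, $y_i=\sin(\theta_i^* )$, lies on $X$. Then $\theta^*$ is not linearly stable.
   Context: An SCT graph is a finite simple connected graph (no loops or multiple edges) in which every vertex has degree at least $2$. Label the vertices $v_0,\ldots,v_{n-1}$ and let $G_i$ be the set of vertices adjacent to $v_i$. The homogeneous Kuramoto system on $G$ is $\dot\theta_i=\sum_{v_j\in G_i}\sin(\theta_j-\theta_i)$; a solution (equilibrium) is a point $\theta^*\in\mathbb{R}^n$ at which all right-hand sides vanish. The Jacobian $J(\theta^* )$ is the $n\times n$ matrix of partial derivatives of the right-hand sides with respect to $\theta_0,\ldots,\theta_{n-1}$ at $\theta^*$; it is symmetric with zero row sums, so $0$ is always an eigenvalue. The solution is linearly stable if all but one of the eigenvalues of $J(\theta^* )$ (counted with multiplicity) are negative. In $\mathbb{C}[x_0,\ldots,x_{n-1},y_0,\ldots,y_{n-1}]$ put $f_i=\sum_{v_j\in G_i}(x_jy_i-x_iy_j)$, $I_G=\langle f_0,\ldots,f_{n-1}\rangle$, $I_\theta=\langle x_i^2+y_i^2-1: 0\le i\le n-1\rangle$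 and $I_K=I_\theta+I_G$; $\mathbb{V}(I_K)\subset\mathbb{C}^{2n}$ is its set of common zeros. The system is invariant under simultaneous rotation of all angles, and this symmetry is removed by the normalization $\theta_0=0$, i.e. $x_0=1$, $y_0=0$. *)

theory Defs
  imports
    "HOL-Analysis.Analysis"
    "HOL-Computational_Algebra.Computational_Algebra"
    "HOL-Library.Poly_Mapping"
    "HOL-Library.Extended_Nat"
begin

text \<open>
  A simple graph is given by its adjacency relation on a finite vertex type \<open>'v\<close>, so that
  \<open>n = CARD('v)\<close> and \<open>G\<^sub>i\<close> is \<open>{j. E i j}\<close>.
\<close>

definition sct_graph :: "('v::finite \<Rightarrow> 'v \<Rightarrow> bool) \<Rightarrow> bool" where
  "sct_graph E \<longleftrightarrow>
     (\<forall>i j. E i j \<longrightarrow> E j i) \<and> (\<forall>i. \<not> E i i) \<and>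
     (\<forall>i j. E\<^sup>*\<^sup>* i j) \<and>
     (\<forall>i. card {j. E i j} \<ge> 2)"

definition kuramoto :: "('v::finite \<Rightarrow> 'v \<Rightarrow> bool) \<Rightarrow> real ^ 'v \<Rightarrow> real ^ 'v" where
  "kuramoto E \<theta> = (\<chi> i. \<Sum>j\<in>{j. E i j}. sin (\<theta> $ j - \<theta> $ i))"

definition kuramoto_solution :: "('v::finite \<Rightarrow> 'v \<Rightarrow> bool) \<Rightarrow> real ^ 'v \<Rightarrow> bool" where
  "kuramoto_solution E \<theta> \<longleftrightarrow> kuramoto E \<theta> = 0"

definition kuramoto_jacobian :: "('v::finite \<Rightarrow> 'v \<Rightarrow> bool) \<Rightarrow> real ^ 'v \<Rightarrow> real ^ 'v ^ 'v" where
  "kuramoto_jacobian E \<theta> = jacobian (kuramoto E) (at \<theta>)"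

definition char_polynomial :: "'a::comm_ring_1 ^ 'n ^ 'n \<Rightarrow> 'a poly" where
  "char_polynomial A = det (\<chi> i j. (if i = j then [:0, 1:] else 0) - [:A $ i $ j:])"

text \<open>
  The \<open>n\<close> eigenvalues, counted with algebraic multiplicity, are the roots of the
  characteristic polynomial. All but one of them are negative iff exactly \<open>n - 1\<close>
  of them are negative (real) numbers, so it is enough to collect the real roots.
\<close>

definition linearly_stable :: "('v::finite \<Rightarrow> 'v \<Rightarrow> bool) \<Rightarrow> real ^ 'v \<Rightarrow> bool" where
  "linearly_stable E \<theta> \<longleftrightarrow>
     size {#l \<in># proots (char_polynomial (kuramoto_jacobian E \<theta>)). l < 0#} = CARD('v) - 1"

text \<open>
  Multivariate polynomials over \<open>\<complex>\<close>: finitely supported maps from monomials (exponent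
  vectors) to coefficients, with the convolution product of \<open>Poly_Mapping\<close>.
\<close>

type_synonym 'k cpoly = "('k \<Rightarrow>\<^sub>0 nat) \<Rightarrow>\<^sub>0 complex"

definition var :: "'k \<Rightarrow> 'k cpoly" where
  "var k = Poly_Mapping.single (Poly_Mapping.single k 1) 1"

definition eval_cpoly :: "'k::finite cpoly \<Rightarrow> complex ^ 'k \<Rightarrow> complex" where
  "eval_cpoly p z =
     (\<Sum>m\<in>Poly_Mapping.keys p.
        Poly_Mapping.lookup p m * (\<Prod>k\<in>UNIV. z $ k ^ Poly_Mapping.lookup m k))"

definition ideal_gen :: "'a::comm_ring_1 set \<Rightarrow> 'a set" where
  "ideal_gen = module.span (*)"

definition common_zeros :: "'k::finite cpoly set \<Rightarrow> (complex ^ 'k) set" where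
  "common_zeros S = {z. \<forall>p\<in>S. eval_cpoly p z = 0}"

definition zariski_closed :: "(complex ^ 'k::finite) set \<Rightarrow> bool" where
  "zariski_closed Z \<longleftrightarrow> (\<exists>S. Z = common_zeros S)"

definition zariski_irreducible :: "(complex ^ 'k::finite) set \<Rightarrow> bool" where
  "zariski_irreducible Z \<longleftrightarrow> zariski_closed Z \<and> Z \<noteq> {} \<and>
     (\<forall>A B. zariski_closed A \<and> zariski_closed B \<and> Z = A \<union> B \<longrightarrow> A = Z \<or> B = Z)"

definition irreducible_component ::
    "(complex ^ 'k::finite) set \<Rightarrow> (complex ^ 'k) set \<Rightarrow> bool" where
  "irreducible_component X W \<longleftrightarrow> zariski_irreducible X \<and> X \<subseteq> W \<and>
     (\<forall>Z. zariski_irreducible Z \<and> X \<subseteq> Z \<and> Z \<subseteq> W \<longrightarrow> Z = X)"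

text \<open>Krull dimension: the supremum of the lengths of strict chains of irreducible closed subsets.\<close>

definition zariski_dim :: "(complex ^ 'k::finite) set \<Rightarrow> enat" where
  "zariski_dim W = Sup {enat d | d. \<exists>Z :: nat \<Rightarrow> (complex ^ 'k) set.
     (\<forall>i\<le>d. zariski_irreducible (Z i) \<and> Z i \<subseteq> W) \<and> (\<forall>i<d. Z i \<subset> Z (Suc i))}"

text \<open>
  The coordinates of \<open>\<complex>\<^sup>2\<^sup>n\<close> are indexed by \<open>'v + 'v\<close>:
  \<open>Inl i\<close> stands for \<open>x\<^sub>i\<close> and \<open>Inr i\<close> for \<open>y\<^sub>i\<close>.
\<close>

definition graph_poly :: "('v::finite \<Rightarrow> 'v \<Rightarrow> bool) \<Rightarrow> 'v \<Rightarrow> ('v + 'v) cpoly" where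
  "graph_poly E i =
     (\<Sum>j\<in>{j. E i j}. var (Inl j) * var (Inr i) - var (Inl i) * var (Inr j))"

definition graph_ideal :: "('v::finite \<Rightarrow> 'v \<Rightarrow> bool) \<Rightarrow> ('v + 'v) cpoly set" where
  "graph_ideal E = ideal_gen (range (graph_poly E))"

definition angle_ideal :: "('v::finite + 'v) cpoly set" where
  "angle_ideal = ideal_gen (range (\<lambda>i. var (Inl i) ^ 2 + var (Inr i) ^ 2 - 1))"

definition kuramoto_ideal :: "('v::finite \<Rightarrow> 'v \<Rightarrow> bool) \<Rightarrow> ('v + 'v) cpoly set" where
  "kuramoto_ideal E = {p + q | p q. p \<in> angle_ideal \<and> q \<in> graph_ideal E}"

definition normalized_solution_set ::
    "('v::finite \<Rightarrow> 'v \<Rightarrow> bool) \<Rightarrow> 'v \<Rightarrow> (complex ^ ('v + 'v)) set" where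
  "normalized_solution_set E v0 =
     common_zeros (kuramoto_ideal E) \<inter> {z. z $ Inl v0 = 1 \<and> z $ Inr v0 = 0}"

definition angle_point :: "real ^ 'v \<Rightarrow> complex ^ ('v::finite + 'v)" where
  "angle_point \<theta> = (\<chi> k. case k of
       Inl i \<Rightarrow> complex_of_real (cos (\<theta> $ i))
     | Inr i \<Rightarrow> complex_of_real (sin (\<theta> $ i)))"

end

theory Submission
  imports Defs
begin

text \<open>
  A linearly stable solution is an isolated point of the normalized solution set, so the only
  irreducible closed set through it inside the solution set is the point itself, whose dimension
  is \<open>0\<close>. Isolation is a matter of a Jacobian of full rank, and since all equations have degree
  two it needs no local algebra. For a quadratic map \<open>f\<close>,
  \[ f(z) - f(p) = Df((z + p)/2)\,(z - p) \]
  holds exactly. Hence if \<open>p\<close> and \<open>z\<close> both solve the system, the vector \<open>z - p\<close> lies in the kernel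
  of a square matrix \<open>M(z)\<close> whose entries are polynomials in \<open>z\<close> and whose value at \<open>p\<close> is, up to
  scaling rows, the Jacobian of the system (\<open>secant_map_diff\<close>). If \<open>M(p)\<close> is injective, then the
  polynomial \<open>det M\<close> vanishes at every solution other than \<open>p\<close> but not at \<open>p\<close>. An irreducible
  set \<open>X\<close> of solutions through \<open>p\<close> is the union of the closed sets \<open>X \<inter> {det M = 0}\<close> and \<open>{p}\<close>,
  hence equal to \<open>{p}\<close> (\<open>irreducible_eq_singleton\<close>).

  It remains to see that linear stability makes \<open>M(p)\<close> injective (\<open>secant_map_injective\<close>).
  A vector in the kernel is tangent to the torus of angles, so it is given by complex numbers
  \<open>\<tau>\<^sub>i\<close>, the variations of the angles \<open>\<theta>\<^sub>i\<close>. The graph equations say that \<open>\<tau>\<close> is annihilated by the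
  rows of the Kuramoto Jacobian \<open>J\<close> other than that of \<open>v0\<close>; the latter row follows because the
  columns of \<open>J\<close> sum to \<open>0\<close>. The normalization gives \<open>\<tau>\<^bsub>v0\<^esub> = 0\<close>. If \<open>J\<close> had a nonzero kernel
  vector vanishing at \<open>v0\<close>, this vector and the constant vector would be two independent kernel
  vectors, \<open>0\<close> would be at least a double root of the characteristic polynomial, and at most
  \<open>n - 2\<close> eigenvalues could be negative (\<open>linearly_stable_kernel\<close>).
\<close>

(* The symbol $ also denotes coefficients of formal power series; below it only means
   vector components. *)
no_notation fps_nth (infixl \<open>$\<close> 75)

section \<open>Polynomial functions and Zariski closed sets\<close>

lemma eval_cpoly_superset:
  assumes "finite A" "Poly_Mapping.keys p \<subseteq> A"
  shows "eval_cpoly p z =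
    (\<Sum>m\<in>A. Poly_Mapping.lookup p m * (\<Prod>k\<in>UNIV. z $ k ^ Poly_Mapping.lookup m k))"
  unfolding eval_cpoly_def
  by (rule sum.mono_neutral_left) (use assms in \<open>auto simp: in_keys_iff\<close>)

lemma eval_cpoly_single:
  "eval_cpoly (Poly_Mapping.single m c) z = c * (\<Prod>k\<in>UNIV. z $ k ^ Poly_Mapping.lookup m k)"
  by (subst eval_cpoly_superset[of "{m}"]) auto

lemma eval_cpoly_0 [simp]: "eval_cpoly 0 z = 0"
  by (simp add: eval_cpoly_def)

lemma eval_cpoly_const [simp]: "eval_cpoly (Poly_Mapping.single 0 c) z = c"
  by (simp add: eval_cpoly_single)

lemma eval_cpoly_1 [simp]: "eval_cpoly 1 z = 1"
  using eval_cpoly_const[of 1 z] by simp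

lemma eval_cpoly_var [simp]: "eval_cpoly (var k) z = z $ k"
proof -
  have "(\<Prod>i\<in>UNIV. z $ i ^ Poly_Mapping.lookup (Poly_Mapping.single k (1::nat)) i)
      = (\<Prod>i\<in>UNIV. if i = k then z $ i else 1)"
    by (intro prod.cong refl) (auto simp: lookup_single)
  then show ?thesis
    by (simp add: var_def eval_cpoly_single)
qed

lemma eval_cpoly_add [simp]: "eval_cpoly (p + q) z = eval_cpoly p z + eval_cpoly q z"
proof -
  let ?A = "Poly_Mapping.keys p \<union> Poly_Mapping.keys q"
  show ?thesis
    using Poly_Mapping.keys_add[of p q]
    by (simp add: eval_cpoly_superset[of ?A] lookup_add sum.distrib distrib_right)
qed

lemma eval_cpoly_uminus [simp]: "eval_cpoly (- p) z = - eval_cpoly p z"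
  using eval_cpoly_add[of p "- p" z] by (simp add: minus_unique)

lemma eval_cpoly_diff [simp]: "eval_cpoly (p - q) z = eval_cpoly p z - eval_cpoly q z"
  using eval_cpoly_add[of p "- q" z] by simp

lemma eval_cpoly_sum [simp]: "eval_cpoly (\<Sum>i\<in>A. f i) z = (\<Sum>i\<in>A. eval_cpoly (f i) z)"
  by (induction A rule: infinite_finite_induct) auto

lemma update_conv_add_single:
  assumes "a \<notin> Poly_Mapping.keys f"
  shows "Poly_Mapping.update a b f = f + Poly_Mapping.single a b"
  using assms
  by (intro poly_mapping_eqI) (auto simp: lookup_update lookup_add lookup_single in_keys_iff)

lemma eval_cpoly_mult [simp]: "eval_cpoly (p * q) z = eval_cpoly p z * eval_cpoly q z"
proof (induction p rule: update_induct)
  case const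
  show ?case by simp
next
  case (update f a b)
  have "eval_cpoly (Poly_Mapping.single a b * q) z = eval_cpoly (Poly_Mapping.single a b) z * eval_cpoly q z"
  proof (induction q rule: update_induct)
    case const
    show ?case by simp
  next
    case (update g a' b')
    have "eval_cpoly (Poly_Mapping.single a b * Poly_Mapping.single a' b') z
        = eval_cpoly (Poly_Mapping.single a b) z * eval_cpoly (Poly_Mapping.single a' b') z"
      by (simp add: mult_single eval_cpoly_single lookup_add power_add prod.distrib)
    with update show ?case
      by (simp add: update_conv_add_single distrib_left)
  qed
  with update show ?case
    by (simp add: update_conv_add_single distrib_right)
qed

definition polynomial_fun :: "(complex ^ 'k::finite \<Rightarrow> complex) \<Rightarrow> bool" where
  "polynomial_fun f \<longleftrightarrow> (\<exists>p. \<forall>z. f z = eval_cpoly p z)"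

lemma polynomial_fun_const: "polynomial_fun (\<lambda>z. c)"
  unfolding polynomial_fun_def by (metis eval_cpoly_const)

lemma polynomial_fun_coord: "polynomial_fun (\<lambda>z. z $ k)"
  unfolding polynomial_fun_def by (metis eval_cpoly_var)

lemma polynomial_fun_add: "polynomial_fun f \<Longrightarrow> polynomial_fun g \<Longrightarrow> polynomial_fun (\<lambda>z. f z + g z)"
  unfolding polynomial_fun_def by (metis eval_cpoly_add)

lemma polynomial_fun_diff: "polynomial_fun f \<Longrightarrow> polynomial_fun g \<Longrightarrow> polynomial_fun (\<lambda>z. f z - g z)"
  unfolding polynomial_fun_def by (metis eval_cpoly_diff)

lemma polynomial_fun_mult: "polynomial_fun f \<Longrightarrow> polynomial_fun g \<Longrightarrow> polynomial_fun (\<lambda>z. f z * g z)"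
  unfolding polynomial_fun_def by (metis eval_cpoly_mult)

lemma polynomial_fun_sum:
  "(\<And>i. i \<in> A \<Longrightarrow> polynomial_fun (f i)) \<Longrightarrow> polynomial_fun (\<lambda>z. \<Sum>i\<in>A. f i z)"
  by (induction A rule: infinite_finite_induct) (auto intro: polynomial_fun_const polynomial_fun_add)

lemma polynomial_fun_prod:
  "(\<And>i. i \<in> A \<Longrightarrow> polynomial_fun (f i)) \<Longrightarrow> polynomial_fun (\<lambda>z. \<Prod>i\<in>A. f i z)"
  by (induction A rule: infinite_finite_induct) (auto intro: polynomial_fun_const polynomial_fun_mult)

lemmas polynomial_fun_intros =
  polynomial_fun_const polynomial_fun_coord polynomial_fun_add polynomial_fun_diff
  polynomial_fun_mult polynomial_fun_sum polynomial_fun_prod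

text \<open>
  The Leibniz formula expresses the determinant as a polynomial in the entries of the matrix.
\<close>

lemma polynomial_fun_det:
  fixes A :: "complex ^ ('k::finite) \<Rightarrow> complex ^ 'n ^ 'n"
  assumes "\<And>i j. polynomial_fun (\<lambda>z. A z $ i $ j)"
  shows "polynomial_fun (\<lambda>z. det (A z))"
  unfolding det_def by (intro polynomial_fun_intros assms)

lemma zariski_closed_zero_set:
  assumes "polynomial_fun f"
  shows "zariski_closed {z. f z = 0}"
proof -
  obtain p where "\<And>z. f z = eval_cpoly p z"
    using assms unfolding polynomial_fun_def by blast
  then have "{z. f z = 0} = common_zeros {p}"
    by (simp add: common_zeros_def)
  then show ?thesis
    unfolding zariski_closed_def by blast
qed

lemma zariski_closed_Int:
  assumes "zariski_closed A" "zariski_closed B"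
  shows "zariski_closed (A \<inter> B)"
proof -
  obtain S T where "A = common_zeros S" "B = common_zeros T"
    using assms unfolding zariski_closed_def by blast
  then have "A \<inter> B = common_zeros (S \<union> T)"
    by (auto simp: common_zeros_def)
  then show ?thesis
    unfolding zariski_closed_def by blast
qed

lemma zariski_closed_singleton: "zariski_closed {p}"
proof -
  have "{p} = common_zeros (range (\<lambda>k. var k - Poly_Mapping.single 0 (p $ k)))"
    by (auto simp: common_zeros_def vec_eq_iff)
  then show ?thesis
    unfolding zariski_closed_def by blast
qed

lemma zariski_dim_singleton: "zariski_dim {p} = 0"
proof -
  have "d = 0"
    if irr: "\<And>i. i \<le> d \<Longrightarrow> zariski_irreducible (Z i) \<and> Z i \<subseteq> {p}"
      and chain: "\<And>i. i < d \<Longrightarrow> Z i \<subset> Z (Suc i)" for d and Z :: "nat \<Rightarrow> _"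
  proof (rule ccontr)
    assume "d \<noteq> 0"
    then have "Z 0 \<subset> Z 1" "Z 1 \<subseteq> {p}" "Z 0 \<noteq> {}"
      using irr[of 0] irr[of 1] chain[of 0] by (auto simp: zariski_irreducible_def)
    then show False
      by auto
  qed
  then have "zariski_dim {p} \<le> 0"
    unfolding zariski_dim_def by (intro Sup_least) (fastforce simp: zero_enat_def)
  then show ?thesis
    by simp
qed

text \<open>
  The isolation criterion. Every \<open>z \<noteq> p\<close> in \<open>X\<close> makes \<open>L z\<close> singular because of the vector \<open>z - p\<close>,
  so the hypersurface where the determinant of \<open>L z\<close> vanishes contains all of \<open>X\<close> except \<open>p\<close>, and
  irreducibility leaves only \<open>p\<close>. In applications \<open>L z\<close> is the linear map with
  \<open>f z - f p = L z (z - p)\<close> for a square system \<open>f\<close>, and \<open>L p\<close> is the derivative at \<open>p\<close>; the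
  criterion then takes the role of the Jacobian criterion and Nakayama's lemma.
\<close>

lemma irreducible_eq_singleton:
  fixes L :: "complex ^ 'k \<Rightarrow> complex ^ 'k \<Rightarrow> complex ^ ('k::finite)"
  assumes irr: "zariski_irreducible X" and "p \<in> X"
    and lin: "\<And>z. Vector_Spaces.linear (*s) (*s) (L z)"
    and poly: "\<And>h r. polynomial_fun (\<lambda>z. L z h $ r)"
    and secant: "\<And>z. z \<in> X \<Longrightarrow> L z (z - p) = 0"
    and inj: "\<And>h. L p h = 0 \<Longrightarrow> h = 0"
  shows "X = {p}"
proof -
  define g where "g z = det (matrix (L z))" for z
  have ker: "g z = 0 \<longleftrightarrow> (\<exists>h. h \<noteq> 0 \<and> L z h = 0)" for z
    using invertible_det_nz[of "matrix (L z)"] invertible_left_inverse[of "matrix (L z)"]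
      matrix_left_invertible_ker[of "matrix (L z)"]
    by (auto simp: g_def matrix_works[OF lin])
  have "polynomial_fun g"
    unfolding g_def by (intro polynomial_fun_det) (simp add: matrix_def poly)
  moreover have "zariski_closed X"
    using irr by (simp add: zariski_irreducible_def)
  ultimately have "zariski_closed (X \<inter> {z. g z = 0})"
    by (intro zariski_closed_Int zariski_closed_zero_set)
  moreover have "X = (X \<inter> {z. g z = 0}) \<union> {p}"
  proof -
    have "g z = 0" if "z \<in> X" "z \<noteq> p" for z
      using secant[OF that(1)] that(2) ker[of z] by (metis right_minus_eq)
    with \<open>p \<in> X\<close> show ?thesis by blast
  qed
  ultimately consider "X \<inter> {z. g z = 0} = X" | "{p} = X"
    using irr zariski_closed_singleton[of p] unfolding zariski_irreducible_def by blast
  then show ?thesis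
  proof cases
    case 1
    with \<open>p \<in> X\<close> have "g p = 0" by blast
    with ker inj show ?thesis by blast
  qed auto
qed

section \<open>The kernel of a linearly stable Jacobian\<close>

lemma det_const_poly:
  fixes A :: "'a::comm_ring_1 ^ 'n ^ 'n"
  shows "det (\<chi> i j. [:A $ i $ j:]) = [:det A:]"
proof -
  have *: "of_int n * [:x:] = [:of_int n * x:]" for n and x :: 'a
    by (simp add: of_int_poly)
  show ?thesis
    by (simp add: det_def prod_to_poly * sum_to_poly del: mult_pCons_right mult_pCons_left)
qed

lemma degree_char_polynomial_le:
  fixes A :: "'a::comm_ring_1 ^ 'n ^ 'n"
  shows "degree (char_polynomial A) \<le> CARD('n)"
proof -
  let ?C = "\<lambda>i j. (if i = j then [:0, 1:] else 0) - [:A $ i $ j:]"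
  have "degree (of_int (sign \<pi>) * (\<Prod>i\<in>UNIV. ?C i (\<pi> i))) \<le> CARD('n)" for \<pi> :: "'n \<Rightarrow> 'n"
  proof -
    have "degree (\<Prod>i\<in>UNIV. ?C i (\<pi> i)) \<le> (\<Sum>i\<in>UNIV. degree (?C i (\<pi> i)))"
      using degree_prod_sum_le[of UNIV "\<lambda>i. ?C i (\<pi> i)"] by (simp add: o_def)
    also have "\<dots> \<le> (\<Sum>i\<in>(UNIV :: 'n set). 1)"
      by (intro sum_mono) auto
    finally show ?thesis
      by (simp add: sign_def)
  qed
  then show ?thesis
    unfolding char_polynomial_def det_def by (intro degree_sum_le) auto
qed

text \<open>
  The part of ``geometric multiplicity is at most algebraic multiplicity'' needed here, for the
  eigenvalue \<open>0\<close> and two independent eigenvectors. Complete \<open>u\<close> and \<open>v\<close> to a basis by unit vectors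
  and let \<open>P\<close> be the matrix of this basis. In \<open>(X - A) P\<close> the columns of \<open>u\<close> and \<open>v\<close> become \<open>X u\<close>
  and \<open>X v\<close>, so a factor \<open>X\<close> can be taken out of each, while \<open>det P\<close> is a nonzero constant. The
  conditions at \<open>a\<close> and \<open>k\<close> express independence in an echelon form that makes \<open>P\<close> explicit.
\<close>

lemma square_dvd_char_polynomial:
  fixes A :: "'a::field ^ 'n ^ 'n"
  assumes "A *v u = 0" "A *v v = 0" and "v $ a \<noteq> 0" "u $ a = 0" "u $ k \<noteq> 0"
  shows "[:0, 1:] ^ 2 dvd char_polynomial A"
proof -
  have "k \<noteq> a" using assms by auto
  define P :: "'a ^ 'n ^ 'n" where
    "P = (\<chi> i j. if j = a then v $ i else if j = k then u $ i else if i = j then 1 else 0)"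
  have "w = 0" if "P *v w = 0" for w
  proof -
    have row: "v $ i * w $ a + u $ i * w $ k + (if i = a \<or> i = k then 0 else w $ i) = 0" for i
    proof -
      have "(P *v w) $ i = (\<Sum>j\<in>UNIV. (if j = a then v $ i * w $ a else 0)
          + (if j = k then u $ i * w $ k else 0)
          + (if j = i then (if i = a \<or> i = k then 0 else w $ i) else 0))"
        unfolding matrix_vector_mult_def P_def using \<open>k \<noteq> a\<close>
        by (auto intro!: sum.cong)
      also have "\<dots> = v $ i * w $ a + u $ i * w $ k + (if i = a \<or> i = k then 0 else w $ i)"
        by (simp add: sum.distrib)
      finally show ?thesis using that by simp
    qed
    have "w $ a = 0" using row[of a] assms by simp
    moreover from this have "w $ k = 0" using row[of k] assms by simp
    ultimately have "w $ i = 0" for i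
      using row[of i] by (auto split: if_splits)
    then show ?thesis by (simp add: vec_eq_iff)
  qed
  then have "det P \<noteq> 0"
    using invertible_det_nz[of P] invertible_left_inverse[of P] matrix_left_invertible_ker[of P]
    by blast
  define C where "C = (\<chi> i j. (if i = j then [:0, 1:] else 0) - [:A $ i $ j:])"
  define P' where "P' = (\<chi> i j. [:P $ i $ j:])"
  define Q where "Q = (\<chi> i j. if j = a \<or> j = k then [:P $ i $ j:] else (C ** P') $ i $ j)"
  define D :: "'a poly ^ 'n ^ 'n" where
    "D = (\<chi> i j. if i = j then (if j = a \<or> j = k then [:0, 1:] else 1) else 0)"
  have CP: "(C ** P') $ i $ j = [:0, 1:] * [:P $ i $ j:] - [:(A ** P) $ i $ j:]" for i j
  proof -
    have "(C ** P') $ i $ j = (\<Sum>l\<in>UNIV. (if l = i then [:0, 1:] * [:P $ i $ j:] else 0)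
        - [:A $ i $ l * P $ l $ j:])"
      unfolding matrix_matrix_mult_def C_def P'_def
      by (auto intro!: sum.cong simp: algebra_simps)
    also have "\<dots> = [:0, 1:] * [:P $ i $ j:] - [:(A ** P) $ i $ j:]"
      by (simp add: sum_subtractf sum_to_poly matrix_matrix_mult_def)
    finally show ?thesis .
  qed
  have "(A ** P) $ i $ j = 0" if "j = a \<or> j = k" for i j
  proof -
    have "(A ** P) $ i $ a = (A *v v) $ i" "(A ** P) $ i $ k = (A *v u) $ i"
      using \<open>k \<noteq> a\<close> by (simp_all add: matrix_matrix_mult_def matrix_vector_mult_def P_def)
    with that assms show ?thesis by auto
  qed
  then have factor: "(C ** P') $ i $ j = Q $ i $ j * D $ j $ j" for i j
    by (auto simp: CP Q_def D_def)
  have "(Q ** D) $ i $ j = Q $ i $ j * D $ j $ j" for i j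
  proof -
    have "(Q ** D) $ i $ j = (\<Sum>l\<in>UNIV. if l = j then Q $ i $ j * D $ j $ j else 0)"
      unfolding matrix_matrix_mult_def vec_lambda_beta
      by (rule sum.cong[OF refl]) (auto simp: D_def)
    then show ?thesis by simp
  qed
  with factor have "C ** P' = Q ** D"
    by (simp add: vec_eq_iff)
  then have "det C * det P' = det Q * det D"
    by (metis det_mul)
  moreover have "det D = [:0, 1:] ^ 2"
  proof -
    have "det D = (\<Prod>i\<in>UNIV. if i = a \<or> i = k then [:0, 1:] else 1)"
      by (subst det_diagonal) (auto simp: D_def)
    also have "\<dots> = (\<Prod>i\<in>{a, k}. [:0, 1:])"
      by (rule prod.mono_neutral_cong_right) auto
    finally show ?thesis using \<open>k \<noteq> a\<close> by (simp add: power2_eq_square)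
  qed
  moreover have "det P' = [:det P:]"
    unfolding P'_def by (rule det_const_poly)
  ultimately have "smult (det P) (char_polynomial A) = det Q * [:0, 1:] ^ 2"
    by (simp add: C_def char_polynomial_def mult.commute)
  then have "[:0, 1:] ^ 2 dvd smult (det P) (char_polynomial A)"
    by (metis dvd_triv_right)
  with \<open>det P \<noteq> 0\<close> show ?thesis
    by (simp add: dvd_smult_iff)
qed

lemma kuramoto_jacobian_mult:
  "(kuramoto_jacobian E \<theta> *v h) $ i = (\<Sum>j | E i j. cos (\<theta> $ j - \<theta> $ i) * (h $ j - h $ i))"
proof -
  let ?D = "\<lambda>h. \<chi> i. \<Sum>j | E i j. cos (\<theta> $ j - \<theta> $ i) * (h $ j - h $ i)"
  have der: "(kuramoto E has_derivative ?D) (at \<theta>)"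
  proof (subst has_derivative_componentwise_within, intro ballI)
    fix b :: "real ^ 'a"
    assume "b \<in> Basis"
    then obtain i where b: "b = axis i 1"
      by (auto simp: Basis_vec_def)
    have "((\<lambda>x. \<Sum>j | E i j. sin (x $ j - x $ i)) has_derivative
        (\<lambda>h. \<Sum>j | E i j. cos (\<theta> $ j - \<theta> $ i) * (h $ j - h $ i))) (at \<theta>)"
      by (auto intro!: derivative_eq_intros sum.cong
          bounded_linear_imp_has_derivative bounded_linear_vec_nth)
    then show "((\<lambda>x. kuramoto E x \<bullet> b) has_derivative (\<lambda>x. ?D x \<bullet> b)) (at \<theta>)"
      by (simp add: b inner_axis kuramoto_def)
  qed
  have "frechet_derivative (kuramoto E) (at \<theta>) = ?D"
    using frechet_derivative_at[OF der] by simp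
  moreover have "kuramoto E differentiable (at \<theta>)"
    using der by (auto simp: differentiable_def)
  then have "(kuramoto E has_derivative (\<lambda>h. kuramoto_jacobian E \<theta> *v h)) (at \<theta>)"
    by (simp add: jacobian_works kuramoto_jacobian_def)
  ultimately have "kuramoto_jacobian E \<theta> *v h = ?D h"
    using frechet_derivative_at by metis
  then show ?thesis by simp
qed

text \<open>
  With \<open>n - 1\<close> negative eigenvalues there is room for only one eigenvalue \<open>0\<close>, already used up by
  the rotational symmetry, that is by the constant vector.
\<close>

lemma linearly_stable_kernel:
  assumes "sct_graph E" "linearly_stable E \<theta>"
    and "kuramoto_jacobian E \<theta> *v u = 0" "u $ a = 0"
  shows "u = 0"
proof (rule ccontr)
  assume "u \<noteq> 0"
  then obtain k where k: "u $ k \<noteq> 0"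
    by (auto simp: vec_eq_iff)
  define q where "q = char_polynomial (kuramoto_jacobian E \<theta>)"
  have stable: "size {#l \<in># proots q. l < 0#} = CARD('a) - 1"
    using assms(2) by (simp add: linearly_stable_def q_def)
  have "2 \<le> card {j. E a j}"
    using assms(1) by (simp add: sct_graph_def)
  also have "\<dots> \<le> CARD('a)"
    by (intro card_mono) auto
  finally have card: "CARD('a) \<ge> 2" .
  (* The zero polynomial has no roots in the sense of proots, which would make the number
     of negative roots 0; two vertices suffice to exclude this. *)
  have "q \<noteq> 0"
    using stable card by auto
  have "kuramoto_jacobian E \<theta> *v 1 = 0"
    by (simp add: vec_eq_iff kuramoto_jacobian_mult)
  then have "[:0, 1:] ^ 2 dvd q"
    unfolding q_def using assms(3,4) k by (intro square_dvd_char_polynomial[of _ u 1 a k]) auto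
  then have "2 \<le> count (proots q) 0"
    using order_divides[of 0 2 q] \<open>q \<noteq> 0\<close> by simp
  moreover have "count (proots q) 0 \<le> size {#l \<in># proots q. \<not> l < 0#}"
    using count_le_size[of "{#l \<in># proots q. \<not> l < 0#}" 0] by simp
  moreover have "size {#l \<in># proots q. l < 0#} + size {#l \<in># proots q. \<not> l < 0#} = size (proots q)"
    by (metis multiset_partition size_union)
  moreover have "size (proots q) \<le> CARD('a)"
    using size_proots_le[of q] degree_char_polynomial_le[of "kuramoto_jacobian E \<theta>"] q_def by simp
  ultimately show False
    using stable card by linarith
qed

section \<open>Secants of the solution set\<close>

text \<open>
  Row \<open>Inl i\<close> is \<open>Df((z + p)/2) h\<close> for the angle equation \<open>f\<close> of the vertex \<open>i\<close>, and row \<open>Inr i\<close> is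
  \<open>2 Df((z + p)/2) h\<close> for its graph equation \<open>f\<close> if \<open>i \<noteq> v0\<close>. The graph equations sum to \<open>0\<close>, so
  that of \<open>v0\<close> follows from the others; its row is given to the normalization \<open>y\<^bsub>v0\<^esub> = 0\<close>, which
  removes the rotations and keeps the system square.
\<close>

definition secant_map ::
    "('v::finite \<Rightarrow> 'v \<Rightarrow> bool) \<Rightarrow> 'v \<Rightarrow> complex ^ ('v + 'v) \<Rightarrow> complex ^ ('v + 'v)
      \<Rightarrow> complex ^ ('v + 'v) \<Rightarrow> complex ^ ('v + 'v)" where
  "secant_map E v0 p z h = (\<chi> r. case r of
      Inl i \<Rightarrow> (z $ Inl i + p $ Inl i) * h $ Inl i + (z $ Inr i + p $ Inr i) * h $ Inr i
    | Inr i \<Rightarrow> if i = v0 then h $ Inr v0 else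
        (\<Sum>j | E i j. (z $ Inr i + p $ Inr i) * h $ Inl j + (z $ Inl j + p $ Inl j) * h $ Inr i
          - (z $ Inr j + p $ Inr j) * h $ Inl i - (z $ Inl i + p $ Inl i) * h $ Inr j))"

lemma secant_map_linear: "Vector_Spaces.linear (*s) (*s) (secant_map E v0 p z)"
proof (unfold_locales, goal_cases)
  case (1 x y)
  show ?case
    by (auto simp: secant_map_def vec_eq_iff algebra_simps sum.distrib sum_subtractf split: sum.split)
next
  case (2 c x)
  show ?case
    by (auto simp: secant_map_def vec_eq_iff algebra_simps sum_distrib_left split: sum.split)
qed

lemma secant_map_polynomial: "polynomial_fun (\<lambda>z. secant_map E v0 p z h $ r)"
proof (cases r)
  case (Inl i)
  then show ?thesis
    by (simp add: secant_map_def) (intro polynomial_fun_intros)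
next
  case (Inr i)
  then show ?thesis
    by (cases "i = v0"; simp add: secant_map_def) (intro polynomial_fun_intros)+
qed

lemma ideal_gen_base: "p \<in> S \<Longrightarrow> p \<in> ideal_gen S"
  and ideal_gen_0: "0 \<in> ideal_gen S" for S :: "'a::comm_ring_1 set"
proof -
  interpret module "(*) :: 'a \<Rightarrow> 'a \<Rightarrow> 'a"
    by unfold_locales (simp_all add: algebra_simps)
  show "p \<in> S \<Longrightarrow> p \<in> ideal_gen S" "0 \<in> ideal_gen S"
    by (simp_all add: ideal_gen_def span_base span_zero)
qed

lemma normalized_solution_setD:
  assumes "z \<in> normalized_solution_set E v0"
  shows "(z $ Inl i)\<^sup>2 + (z $ Inr i)\<^sup>2 = 1"
    and "(\<Sum>j | E i j. z $ Inl j * z $ Inr i - z $ Inl i * z $ Inr j) = 0"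
    and "z $ Inr v0 = 0"
proof -
  have vanish: "eval_cpoly (p + q) z = 0" if "p \<in> angle_ideal" "q \<in> graph_ideal E" for p q
    using assms that
    unfolding normalized_solution_set_def common_zeros_def kuramoto_ideal_def by blast
  have "eval_cpoly (var (Inl i) ^ 2 + var (Inr i) ^ 2 - 1 + 0) z = 0"
    by (rule vanish) (auto simp: angle_ideal_def graph_ideal_def intro: ideal_gen_base ideal_gen_0)
  then show "(z $ Inl i)\<^sup>2 + (z $ Inr i)\<^sup>2 = 1"
    by (simp add: power2_eq_square)
  have "eval_cpoly (0 + graph_poly E i) z = 0"
    by (rule vanish) (auto simp: angle_ideal_def graph_ideal_def intro: ideal_gen_base ideal_gen_0)
  then show "(\<Sum>j | E i j. z $ Inl j * z $ Inr i - z $ Inl i * z $ Inr j) = 0"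
    by (simp add: graph_poly_def)
  show "z $ Inr v0 = 0"
    using assms by (simp add: normalized_solution_set_def)
qed

lemma secant_map_diff:
  assumes p: "p \<in> normalized_solution_set E v0" and z: "z \<in> normalized_solution_set E v0"
  shows "secant_map E v0 p z (z - p) = 0"
proof -
  have "secant_map E v0 p z (z - p) $ Inl i = 0" for i
  proof -
    have "secant_map E v0 p z (z - p) $ Inl i
        = ((z $ Inl i)\<^sup>2 + (z $ Inr i)\<^sup>2) - ((p $ Inl i)\<^sup>2 + (p $ Inr i)\<^sup>2)"
      by (simp add: secant_map_def algebra_simps power2_eq_square)
    then show ?thesis
      by (simp add: normalized_solution_setD(1)[OF p] normalized_solution_setD(1)[OF z])
  qed
  moreover have "secant_map E v0 p z (z - p) $ Inr i = 0" for i
  proof (cases "i = v0")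
    case True
    then show ?thesis
      by (simp add: secant_map_def normalized_solution_setD(3)[OF p] normalized_solution_setD(3)[OF z])
  next
    case False
    then have "secant_map E v0 p z (z - p) $ Inr i
        = (\<Sum>j | E i j. 2 * (z $ Inl j * z $ Inr i - z $ Inl i * z $ Inr j)
            - 2 * (p $ Inl j * p $ Inr i - p $ Inl i * p $ Inr j))"
      by (simp add: secant_map_def) (intro sum.cong refl, simp add: algebra_simps)
    also have "\<dots> = 2 * (\<Sum>j | E i j. z $ Inl j * z $ Inr i - z $ Inl i * z $ Inr j)
            - 2 * (\<Sum>j | E i j. p $ Inl j * p $ Inr i - p $ Inl i * p $ Inr j)"
      by (subst sum_subtractf) (simp only: sum_distrib_left)
    finally show ?thesis
      by (simp add: normalized_solution_setD(2)[OF p] normalized_solution_setD(2)[OF z])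
  qed
  ultimately have "secant_map E v0 p z (z - p) $ r = 0" for r
    by (cases r) auto
  then show ?thesis
    by (simp add: vec_eq_iff)
qed

text \<open>
  Each edge contributes twice, with opposite signs.
\<close>

lemma weighted_laplacian_sum:
  fixes \<tau> :: "'v::finite \<Rightarrow> complex"
  assumes "\<And>i j. E i j \<Longrightarrow> E j i" "\<And>i j. w i j = w j i"
  shows "(\<Sum>i\<in>UNIV. \<Sum>j | E i j. w i j * (\<tau> j - \<tau> i)) = 0"
proof -
  let ?f = "\<lambda>i j. if E i j then w i j * (\<tau> j - \<tau> i) else 0"
  have eq: "(\<Sum>j | E i j. w i j * (\<tau> j - \<tau> i)) = (\<Sum>j\<in>UNIV. ?f i j)" for i
    by (simp add: sum.If_cases)
  have "(\<Sum>i\<in>UNIV. \<Sum>j\<in>UNIV. ?f i j) = (\<Sum>j\<in>UNIV. \<Sum>i\<in>UNIV. ?f i j)"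
    by (rule sum.swap)
  also have "\<dots> = (\<Sum>j\<in>UNIV. \<Sum>i\<in>UNIV. - ?f j i)"
  proof (intro sum.cong refl)
    fix i j
    show "?f i j = - ?f j i"
      using assms(1)[of i j] assms(1)[of j i] assms(2)[of i j] by (auto simp: algebra_simps)
  qed
  also have "\<dots> = - (\<Sum>i\<in>UNIV. \<Sum>j\<in>UNIV. ?f i j)"
    by (simp add: sum_negf)
  finally show ?thesis
    unfolding eq by simp
qed

text \<open>
  Put \<open>c\<^sub>i = cos \<theta>\<^sub>i\<close> and \<open>s\<^sub>i = sin \<theta>\<^sub>i\<close>. The angle rows say that the pair
  \<open>(h\<^sub>x, h\<^sub>y)\<close> at \<open>i\<close> is orthogonal to \<open>(c\<^sub>i, s\<^sub>i)\<close>, hence equal to \<open>\<tau>\<^sub>i (- s\<^sub>i, c\<^sub>i)\<close>. Substituting this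
  into the graph rows turns them into \<open>- 2\<close> times the rows of the Kuramoto Jacobian applied to \<open>\<tau>\<close>.
  As this Jacobian is real, it annihilates the real and the imaginary part of \<open>\<tau>\<close> separately.
\<close>

lemma secant_map_injective:
  assumes sct: "sct_graph E" and stable: "linearly_stable E \<theta>" and v0: "\<theta> $ v0 = 0"
    and h: "secant_map E v0 (angle_point \<theta>) (angle_point \<theta>) h = 0"
  shows "h = 0"
proof -
  define c s :: "'a \<Rightarrow> complex" where "c i = of_real (cos (\<theta> $ i))" and "s i = of_real (sin (\<theta> $ i))" for i
  define \<tau> where "\<tau> i = c i * h $ Inr i - s i * h $ Inl i" for i
  define w :: "'a \<Rightarrow> 'a \<Rightarrow> complex" where "w i j = of_real (cos (\<theta> $ j - \<theta> $ i))" for i j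
  have w: "w i j = c i * c j + s i * s j" for i j
    by (simp add: w_def c_def s_def cos_diff)
  have p: "angle_point \<theta> $ Inl i = c i" "angle_point \<theta> $ Inr i = s i" for i
    by (simp_all add: angle_point_def c_def s_def)
  have row: "secant_map E v0 (angle_point \<theta>) (angle_point \<theta>) h $ r = 0" for r
    using h by simp
  have cs: "c i * c i + s i * s i = 1" for i
    using sin_cos_squared_add3[of "\<theta> $ i"] unfolding c_def s_def
    by (metis of_real_1 of_real_add of_real_mult)
  have orth: "c i * h $ Inl i + s i * h $ Inr i = 0" for i
  proof -
    have "2 * (c i * h $ Inl i + s i * h $ Inr i) = 0"
      using row[of "Inl i"] by (simp add: secant_map_def p algebra_simps)
    then show ?thesis
      unfolding mult_eq_0_iff by simp
  qed
  have hx: "h $ Inl i = - s i * \<tau> i" and hy: "h $ Inr i = c i * \<tau> i" for i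
  proof -
    have "h $ Inl i + s i * \<tau> i = (1 - (c i * c i + s i * s i)) * h $ Inl i
        + c i * (c i * h $ Inl i + s i * h $ Inr i)"
      "h $ Inr i - c i * \<tau> i = (1 - (c i * c i + s i * s i)) * h $ Inr i
        + s i * (c i * h $ Inl i + s i * h $ Inr i)"
      by (simp_all add: \<tau>_def algebra_simps)
    then have "h $ Inl i + s i * \<tau> i = 0" "h $ Inr i - c i * \<tau> i = 0"
      unfolding cs orth by simp_all
    then show "h $ Inl i = - s i * \<tau> i" "h $ Inr i = c i * \<tau> i"
      by (simp_all add: eq_neg_iff_add_eq_0)
  qed
  have off: "(\<Sum>j | E i j. w i j * (\<tau> j - \<tau> i)) = 0" if "i \<noteq> v0" for i
  proof -
    have "0 = secant_map E v0 (angle_point \<theta>) (angle_point \<theta>) h $ Inr i"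
      using row by simp
    also have "\<dots> = (\<Sum>j | E i j. - 2 * (w i j * (\<tau> j - \<tau> i)))"
      using that by (simp add: secant_map_def p hx hy w) (intro sum.cong refl, simp add: algebra_simps)
    also have "\<dots> = - 2 * (\<Sum>j | E i j. w i j * (\<tau> j - \<tau> i))"
      by (simp only: sum_distrib_left)
    finally show ?thesis by simp
  qed
  have all: "(\<Sum>j | E i j. w i j * (\<tau> j - \<tau> i)) = 0" for i
  proof (cases "i = v0")
    case True
    have "0 = (\<Sum>i\<in>UNIV. \<Sum>j | E i j. w i j * (\<tau> j - \<tau> i))"
      using sct by (subst weighted_laplacian_sum) (auto simp: sct_graph_def w mult.commute)
    also have "\<dots> = (\<Sum>i\<in>{v0}. \<Sum>j | E i j. w i j * (\<tau> j - \<tau> i))"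
      by (rule sum.mono_neutral_right) (auto simp: off)
    finally show ?thesis using True by simp
  qed (rule off)
  have "h $ Inr v0 = 0"
    using row[of "Inr v0"] by (simp add: secant_map_def)
  then have \<tau>0: "\<tau> v0 = 0"
    by (simp add: \<tau>_def s_def v0)
  have "(\<chi> i. Re (\<tau> i)) = 0"
  proof (rule linearly_stable_kernel[OF sct stable, of _ v0])
    show "kuramoto_jacobian E \<theta> *v (\<chi> i. Re (\<tau> i)) = 0"
      using arg_cong[OF all, of Re]
      by (simp add: vec_eq_iff kuramoto_jacobian_mult w_def)
  qed (simp add: \<tau>0)
  moreover have "(\<chi> i. Im (\<tau> i)) = 0"
  proof (rule linearly_stable_kernel[OF sct stable, of _ v0])
    show "kuramoto_jacobian E \<theta> *v (\<chi> i. Im (\<tau> i)) = 0"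
      using arg_cong[OF all, of Im]
      by (simp add: vec_eq_iff kuramoto_jacobian_mult w_def)
  qed (simp add: \<tau>0)
  ultimately have "\<tau> i = 0" for i
    by (simp add: vec_eq_iff complex_eq_iff)
  then have "h $ r = 0" for r
    by (cases r) (simp_all add: hx hy)
  then show ?thesis
    by (simp add: vec_eq_iff)
qed

section \<open>Stable solutions are isolated\<close>

theorem mainTheorem5:
  fixes E :: "'v::finite \<Rightarrow> 'v \<Rightarrow> bool"
    and v0 :: 'v
    and X :: "(complex ^ ('v + 'v)) set"
    and \<theta> :: "real ^ 'v"
  assumes "sct_graph E"
    and "irreducible_component X (normalized_solution_set E v0)"
    and "zariski_dim X > 0"
    and "\<theta> $ v0 = 0"
    and "kuramoto_solution E \<theta>"
    and "angle_point \<theta> \<in> X"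
  shows "\<not> linearly_stable E \<theta>"
proof
  assume stable: "linearly_stable E \<theta>"
  have irr: "zariski_irreducible X" and sub: "X \<subseteq> normalized_solution_set E v0"
    using assms(2) by (auto simp: irreducible_component_def)
  have "X = {angle_point \<theta>}"
  proof (rule irreducible_eq_singleton[OF irr assms(6)])
    show "secant_map E v0 (angle_point \<theta>) z (z - angle_point \<theta>) = 0" if "z \<in> X" for z
      using that sub assms(6) by (blast intro: secant_map_diff)
    show "h = 0" if "secant_map E v0 (angle_point \<theta>) (angle_point \<theta>) h = 0" for h
      using secant_map_injective[OF assms(1) stable assms(4) that] .
  qed (rule secant_map_linear secant_map_polynomial)+
  with assms(3) show False
    by (simp add: zariski_dim_singleton)
qed

end
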